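(* Let $R$ be an associative ring with identity satisfying at least one of the following two conditions. (1) There is no infinite ascending chain of principal right ideals $a_1R\subseteq a_2R\subseteq\cdots$ such that each $a_i\in R$ is nilpotent and the index of nilpotence of each $a_i$ is less than that of $a_{i+1}$. (2) There is no infinite descending chain $l_R(a_1)\supseteq l_R(a_2)\supseteq\cdots$ such that each $a_i\in R$ is nilpotent and the index of nilpotence of each $a_i$ is less than that of $a_{i+1}$. Then $R$ is right Dischinger.
   Context: For $a\in R$, $l_R(a)=\{r\in R: ra=0\}$ is the left annihilator. The index of nilpotence of a nilpotent element $a$ is the least integer $n\ge1$ with $a^n=0$. An element $a\in R$ is right strongly regular if $a=a^2x$ for some $x\in R$, left strongly regular if $a=ya^2$ for some $y\in R$, and strongly regular if both. A ring $R$ is right Dischinger if every right strongly regular element of $R$ is strongly regular (equivalently, whenever $a=a^2x$ with $a,x\in R$, there is $y\in R$ with $a=ya^2$). *)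

theory Defs
  imports Main
begin

text \<open>
  Associative rings with identity are modelled by the sort \<open>{ring, monoid_mult}\<close>, which, unlike
  \<open>ring_1\<close>, does not exclude the zero ring.
\<close>

definition principal_right_ideal :: "'a::{ring, monoid_mult} \<Rightarrow> 'a set" where
  "principal_right_ideal a = {a * r | r. True}"

definition left_annihilator :: "'a::{ring, monoid_mult} \<Rightarrow> 'a set" where
  "left_annihilator a = {r. r * a = 0}"

definition nilpotent :: "'a::{ring, monoid_mult} \<Rightarrow> bool" where
  "nilpotent a \<longleftrightarrow> (\<exists>n\<ge>1. a ^ n = 0)"

text \<open>Only meaningful for nilpotent elements. The bound \<open>n \<ge> 1\<close> matters in the zero ring.\<close>

definition nilpotence_index :: "'a::{ring, monoid_mult} \<Rightarrow> nat" where
  "nilpotence_index a = (LEAST n. n \<ge> 1 \<and> a ^ n = 0)"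

definition right_strongly_regular :: "'a::{ring, monoid_mult} \<Rightarrow> bool" where
  "right_strongly_regular a \<longleftrightarrow> (\<exists>x. a = a ^ 2 * x)"

definition left_strongly_regular :: "'a::{ring, monoid_mult} \<Rightarrow> bool" where
  "left_strongly_regular a \<longleftrightarrow> (\<exists>y. a = y * a ^ 2)"

definition strongly_regular :: "'a::{ring, monoid_mult} \<Rightarrow> bool" where
  "strongly_regular a \<longleftrightarrow> right_strongly_regular a \<and> left_strongly_regular a"

definition right_Dischinger :: "'a::{ring, monoid_mult} itself \<Rightarrow> bool" where
  "right_Dischinger _ \<longleftrightarrow> (\<forall>a::'a. right_strongly_regular a \<longrightarrow> strongly_regular a)"

text \<open>
  The inclusions in the following two chain conditions are not required to be proper;
  only the indices of nilpotence increase strictly.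
\<close>

definition no_ascending_nilpotent_chain :: "'a::{ring, monoid_mult} itself \<Rightarrow> bool" where
  "no_ascending_nilpotent_chain _ \<longleftrightarrow>
     \<not> (\<exists>a :: nat \<Rightarrow> 'a. \<forall>i.
          principal_right_ideal (a i) \<subseteq> principal_right_ideal (a (Suc i)) \<and>
          nilpotent (a i) \<and> nilpotence_index (a i) < nilpotence_index (a (Suc i)))"

definition no_descending_annihilator_chain :: "'a::{ring, monoid_mult} itself \<Rightarrow> bool" where
  "no_descending_annihilator_chain _ \<longleftrightarrow>
     \<not> (\<exists>a :: nat \<Rightarrow> 'a. \<forall>i.
          left_annihilator (a i) \<supseteq> left_annihilator (a (Suc i)) \<and>
          nilpotent (a i) \<and> nilpotence_index (a i) < nilpotence_index (a (Suc i)))"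

end

theory Submission imports Defs begin

text \<open>
  Let \<open>a = a\<^sup>2 x\<close> and suppose that \<open>a \<notin> R a\<^sup>2\<close>. Left multiplication by \<open>a\<close> maps the right ideal
  \<open>aR\<close> onto itself, and the failure of \<open>a \<in> R a\<^sup>2\<close> means that the kernels of its powers on \<open>aR\<close> keep
  growing. When \<open>a x = 1\<close> this is the Dedekind-infinite situation, in which the idempotents
  \<open>1 - x\<^sup>n a\<^sup>n\<close> project onto those kernels, and \<open>a\<close> cut down to the \<open>n\<close>-th kernel is a nilpotent
  Jordan block.

  The point is that the same formula works without \<open>a x = 1\<close>, where \<open>1 - x\<^sup>n a\<^sup>n\<close> need no longer
  be idempotent. Put \<open>p\<^sub>n = a (1 - x\<^sup>n a\<^sup>n)\<close>. From \<open>a\<^sup>n\<^sup>+\<^sup>1 x\<^sup>n = a\<close> one gets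
  \<open>a\<^sup>m (1 - x\<^sup>n a\<^sup>n) = 0\<close> for \<open>m > n\<close>, and everything follows from these two identities.
  The powers are \<open>p\<^sub>n\<^sup>k = a\<^sup>k (1 - x\<^sup>n a\<^sup>n)\<close> for \<open>k \<ge> 1\<close> (\<open>truncation_power\<close>), so \<open>p\<^sub>n\<close> is nilpotent
  of index at most \<open>n + 1\<close>. If \<open>p\<^sub>n\<^sup>k = 0\<close> with \<open>1 \<le> k < n\<close>, then \<open>a\<^sup>k = a\<^sup>k x\<^sup>n a\<^sup>n \<in> R a\<^sup>k\<^sup>+\<^sup>1\<close>, and
  multiplying by \<open>x\<^sup>k\<^sup>-\<^sup>1\<close> on the right yields \<open>a \<in> R a\<^sup>2\<close>; hence the index is \<open>n\<close> or \<open>n + 1\<close>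
  (\<open>truncation_index_bounds\<close>).
  Finally \<open>p\<^sub>n = p\<^sub>m (1 - x\<^sup>n a\<^sup>n)\<close> for \<open>m > n\<close> (\<open>truncation_factor\<close>), so the right ideals
  \<open>p\<^sub>n R\<close> ascend. Therefore \<open>p\<^sub>1, p\<^sub>3, p\<^sub>5, \<dots>\<close> violates the first chain condition. It violates the
  second one as well, because \<open>aR \<subseteq> bR\<close> implies that the left annihilator of \<open>a\<close> contains that
  of \<open>b\<close>.
\<close>

definition truncation :: "'a::{ring, monoid_mult} \<Rightarrow> 'a \<Rightarrow> nat \<Rightarrow> 'a" where
  "truncation a x n = a * (1 - x ^ n * a ^ n)"

lemma power_Suc_mult_power_cancel:
  fixes a x :: "'a::monoid_mult"
  assumes "a = a ^ 2 * x"
  shows "a ^ Suc n * x ^ n = a"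
proof (induction n)
  case 0
  show ?case by simp
next
  case (Suc n)
  have "a ^ Suc (Suc n) * x ^ Suc n = a ^ n * (a ^ 2 * x) * x ^ n"
    by (simp only: power_Suc2[of a] power_Suc[of x] power2_eq_square mult.assoc)
  also have "\<dots> = a ^ Suc n * x ^ n"
    by (simp only: assms[symmetric] power_Suc2[of a])
  finally show ?case using Suc by simp
qed

lemma power_mult_complement_eq_0:
  fixes a x :: "'a::{ring, monoid_mult}"
  assumes "a = a ^ 2 * x" and "n < m"
  shows "a ^ m * (1 - x ^ n * a ^ n) = 0"
proof -
  obtain d where m: "m = d + Suc n"
    using \<open>n < m\<close> by (metis Suc_leI add.commute le_Suc_ex)
  have "a ^ Suc n * (x ^ n * a ^ n) = a ^ Suc n"
    using power_Suc_mult_power_cancel[OF assms(1), of n]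
    by (metis mult.assoc power_Suc)
  hence "a ^ Suc n * (1 - x ^ n * a ^ n) = 0"
    by (simp only: right_diff_distrib mult_1_right) simp
  thus ?thesis
    unfolding m by (simp only: power_add mult.assoc mult_zero_right)
qed

text \<open>
  In the induction step, multiplying \<open>a\<^sup>k (1 - x\<^sup>n a\<^sup>n)\<close> by \<open>a (1 - x\<^sup>n a\<^sup>n)\<close> produces the cross term
  \<open>a\<^sup>k x\<^sup>n a\<^sup>n\<^sup>+\<^sup>1 (1 - x\<^sup>n a\<^sup>n)\<close>, which vanishes; this is why only one factor \<open>1 - x\<^sup>n a\<^sup>n\<close> survives
  although it need not be idempotent.
\<close>

lemma truncation_power:
  fixes a x :: "'a::{ring, monoid_mult}"
  assumes "a = a ^ 2 * x"
  shows "truncation a x n ^ Suc k = a ^ Suc k * (1 - x ^ n * a ^ n)"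
proof (induction k)
  case 0
  show ?case by (simp add: truncation_def)
next
  case (Suc k)
  define e where "e = 1 - x ^ n * a ^ n"
  have zero: "a ^ n * (a * e) = 0"
    using power_mult_complement_eq_0[OF assms, of n "Suc n"]
    by (simp only: e_def power_Suc2 mult.assoc lessI)
  have "truncation a x n ^ Suc (Suc k) = a ^ Suc k * e * (a * e)"
    using Suc by (simp only: power_Suc2[of _ "Suc k"] e_def truncation_def)
  also have "\<dots> = a ^ Suc k * (a * e) - a ^ Suc k * x ^ n * (a ^ n * (a * e))"
    by (subst (1) e_def)
      (simp only: right_diff_distrib left_diff_distrib mult_1_right mult.assoc)
  also have "\<dots> = a ^ Suc (Suc k) * e"
    by (simp only: zero mult_zero_right diff_zero power_Suc2[of _ "Suc k"] mult.assoc)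
  finally show ?case by (simp only: e_def)
qed

lemma truncation_factor:
  fixes a x :: "'a::{ring, monoid_mult}"
  assumes "a = a ^ 2 * x" and "n < m"
  shows "truncation a x n = truncation a x m * (1 - x ^ n * a ^ n)"
proof -
  define e where "e = 1 - x ^ n * a ^ n"
  have zero: "a ^ m * e = 0"
    using power_mult_complement_eq_0[OF assms] by (simp only: e_def)
  have "truncation a x m * e = a * e - a * x ^ m * (a ^ m * e)"
    by (simp only: truncation_def right_diff_distrib left_diff_distrib mult_1_right mult.assoc)
  thus ?thesis
    by (simp only: zero mult_zero_right diff_zero) (simp only: e_def truncation_def)
qed

lemma nilpotence_index_le:
  assumes "n \<ge> 1" and "a ^ n = 0"
  shows "nilpotence_index a \<le> n"
  unfolding nilpotence_index_def using assms by (simp add: Least_le)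

lemma nilpotent_power_index:
  assumes "nilpotent a"
  shows "nilpotence_index a \<ge> 1 \<and> a ^ nilpotence_index a = 0"
  using assms unfolding nilpotent_def nilpotence_index_def by (metis (mono_tags, lifting) LeastI)

text \<open>
  Since \<open>a \<in> a\<^sup>k R\<close>, membership of \<open>a\<^sup>k\<close> in \<open>R a\<^sup>k\<^sup>+\<^sup>1\<close> can be cancelled down to the first power.
\<close>

lemma left_strongly_regular_of_power:
  fixes a x :: "'a::{ring, monoid_mult}"
  assumes "a = a ^ 2 * x" and "a ^ Suc k = r * a ^ Suc (Suc k)"
  shows "left_strongly_regular a"
proof -
  have "a = a ^ Suc k * x ^ k"
    using power_Suc_mult_power_cancel[OF assms(1)] by simp
  also have "\<dots> = r * (a * (a ^ Suc k * x ^ k))"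
    by (subst assms(2)) (simp only: power_Suc[of _ "Suc k"] mult.assoc)
  also have "\<dots> = r * a ^ 2"
    by (simp only: power_Suc_mult_power_cancel[OF assms(1)] power2_eq_square)
  finally show ?thesis
    unfolding left_strongly_regular_def by blast
qed

lemma truncation_nilpotent:
  fixes a x :: "'a::{ring, monoid_mult}"
  assumes "a = a ^ 2 * x"
  shows "truncation a x n ^ Suc n = 0" and "nilpotent (truncation a x n)"
proof -
  show *: "truncation a x n ^ Suc n = 0"
    by (simp only: truncation_power[OF assms] power_mult_complement_eq_0[OF assms lessI])
  show "nilpotent (truncation a x n)"
    unfolding nilpotent_def using * by (metis One_nat_def Suc_le_mono zero_le)
qed

lemma truncation_index_bounds:
  fixes a x :: "'a::{ring, monoid_mult}"
  assumes "a = a ^ 2 * x" and "\<not> left_strongly_regular a"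
  shows "n \<le> nilpotence_index (truncation a x n)"
    and "nilpotence_index (truncation a x n) \<le> Suc n"
proof -
  show "nilpotence_index (truncation a x n) \<le> Suc n"
    using truncation_nilpotent(1)[OF assms(1)] by (intro nilpotence_index_le) auto
  show "n \<le> nilpotence_index (truncation a x n)"
  proof (rule ccontr)
    assume less: "\<not> n \<le> nilpotence_index (truncation a x n)"
    obtain k where k: "nilpotence_index (truncation a x n) = Suc k"
      using nilpotent_power_index[OF truncation_nilpotent(2)[OF assms(1)]]
      by (metis Suc_le_D One_nat_def)
    have "truncation a x n ^ Suc k = 0"
      using nilpotent_power_index[OF truncation_nilpotent(2)[OF assms(1)]] k by metis
    hence "a ^ Suc k = a ^ Suc k * (x ^ n * a ^ n)"
      unfolding truncation_power[OF assms(1)] by (simp only: right_diff_distrib mult_1_right right_minus_eq)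
    moreover obtain d where "n = d + Suc (Suc k)"
      using less k by (metis not_le Suc_leI add.commute le_Suc_ex)
    ultimately have "a ^ Suc k = (a ^ Suc k * x ^ n * a ^ d) * a ^ Suc (Suc k)"
      by (metis mult.assoc power_add)
    thus False
      using left_strongly_regular_of_power assms by blast
  qed
qed

lemma principal_right_ideal_subset_left_annihilator:
  assumes "principal_right_ideal a \<subseteq> principal_right_ideal b"
  shows "left_annihilator b \<subseteq> left_annihilator a"
proof -
  have "a \<in> principal_right_ideal a"
    unfolding principal_right_ideal_def by (metis (mono_tags) mem_Collect_eq mult_1_right)
  then obtain r where "a = b * r"
    using assms unfolding principal_right_ideal_def by auto
  thus ?thesis
    unfolding left_annihilator_def by (auto simp flip: mult.assoc)
qed

text \<open>
  The index of \<open>p\<^sub>n\<close> is only known up to \<open>1\<close>, so every second \<open>n\<close> is taken to make the indices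
  increase strictly.
\<close>

lemma ascending_nilpotent_chain:
  fixes a :: "'a::{ring, monoid_mult}"
  assumes "right_strongly_regular a" and "\<not> left_strongly_regular a"
  shows "\<exists>p :: nat \<Rightarrow> 'a. \<forall>i. principal_right_ideal (p i) \<subseteq> principal_right_ideal (p (Suc i)) \<and>
           nilpotent (p i) \<and> nilpotence_index (p i) < nilpotence_index (p (Suc i))"
proof -
  obtain x where x: "a = a ^ 2 * x"
    using assms(1) unfolding right_strongly_regular_def by blast
  define p where "p i = truncation a x (2 * i + 1)" for i
  have "principal_right_ideal (p i) \<subseteq> principal_right_ideal (p (Suc i))" for i
  proof -
    obtain e where "p i = p (Suc i) * e"
      unfolding p_def using truncation_factor[OF x, of "2 * i + 1" "2 * Suc i + 1"] by auto
    thus ?thesis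
      unfolding principal_right_ideal_def by (auto simp: mult.assoc)
  qed
  moreover have "nilpotent (p i)" for i
    unfolding p_def by (rule truncation_nilpotent(2)[OF x])
  moreover have "nilpotence_index (p i) < nilpotence_index (p (Suc i))" for i
    unfolding p_def
    by (rule le_less_trans[OF truncation_index_bounds(2)[OF x assms(2)]
          less_le_trans[OF _ truncation_index_bounds(1)[OF x assms(2)]]]) simp
  ultimately show ?thesis by blast
qed

theorem theorem2p10:
  assumes "no_ascending_nilpotent_chain TYPE('a::{ring, monoid_mult})
           \<or> no_descending_annihilator_chain TYPE('a)"
  shows "right_Dischinger TYPE('a)"
proof (rule ccontr)
  assume "\<not> right_Dischinger TYPE('a)"
  then obtain a :: 'a where "right_strongly_regular a" "\<not> left_strongly_regular a"
    unfolding right_Dischinger_def strongly_regular_def by blast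
  hence ascending: "\<exists>p :: nat \<Rightarrow> 'a. \<forall>i.
      principal_right_ideal (p i) \<subseteq> principal_right_ideal (p (Suc i)) \<and>
      nilpotent (p i) \<and> nilpotence_index (p i) < nilpotence_index (p (Suc i))"
    by (rule ascending_nilpotent_chain)
  have "\<not> no_ascending_nilpotent_chain TYPE('a)"
    unfolding no_ascending_nilpotent_chain_def using ascending by simp
  moreover have "\<not> no_descending_annihilator_chain TYPE('a)"
    unfolding no_descending_annihilator_chain_def
    using ascending principal_right_ideal_subset_left_annihilator by meson
  ultimately show False using assms by blast
qed

end
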